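(* Let $n,d\ge1$ be integers and let $\mathbb{F}$ be a field with $\mathrm{char}(\mathbb{F})=0$ or $\mathrm{char}(\mathbb{F})>d$. Then the map $$(S_{n,d}(\mathbb{F}),\mathrm{d}_{\mathrm{ess}})\longrightarrow\left(\mathbb{F}^{n\times\binom{n+d-2}{d-1}},\mathrm{d}_{\mathrm{rk}}\right),\qquad f\longmapsto C_f,$$ is an $\mathbb{F}$-linear isometric embedding.
   Context: $S_{n,d}(\mathbb{F})=\mathbb{F}[x_1,\ldots,x_n]_d$ is the space of homogeneous polynomials of degree $d$ (including $0$). Essential rank: for $f\in S_{n,d}(\mathbb{F})$, $\mathrm{ess}(f)$ is the minimal $r\in\mathbb{Z}_{\ge0}$ such that there are linear forms $\ell_1,\ldots,\ell_r\in S_{n,1}(\mathbb{F})$ with $f\in\mathbb{F}[\ell_1,\ldots,\ell_r]$. The metric $\mathrm{d}_{\mathrm{ess}}$ on $S_{n,d}(\mathbb{F})$ is $\mathrm{d}_{\mathrm{ess}}(f,g)=\mathrm{ess}(f-g)$. The rank distance on matrices is $\mathrm{d}_{\mathrm{rk}}(A,B)=\mathrm{rk}(A-B)$. First catalecticant matrix: let $z_1,\ldots,z_m$ be the monomial basis of $S_{n,d-1}(\mathbb{F})$ ordered lexicographically, $m=\binom{n+d-2}{d-1}$. For $f\in S_{n,d}(\mathbb{F})$, $C_f\in\mathbb{F}^{n\times m}$ is the matrix with $\frac{\partial f}{\partial x_i}=\sum_{j=1}^m(C_f)_{i,j}z_j$ for $i=1,\ldots,n$. *)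

theory Defs
  imports
    "HOL-Library.Poly_Mapping"
    "HOL-Computational_Algebra.Computational_Algebra"
    "Jordan_Normal_Form.DL_Rank"
begin

text \<open>
  A polynomial is a finitely supported map from exponent vectors to coefficients, with the
  convolution product of \<^theory>\<open>HOL-Library.Poly_Mapping\<close>. Variables are numbered from 0, so the
  variables $x_1, \ldots, x_n$ are those with index \<open>i < n\<close>.
\<close>

type_synonym 'a mpol = "(nat \<Rightarrow>\<^sub>0 nat) \<Rightarrow>\<^sub>0 'a"

definition Const :: "'a::zero \<Rightarrow> 'a mpol" where
  "Const c = Poly_Mapping.single 0 c"

definition exponents :: "nat \<Rightarrow> nat \<Rightarrow> (nat \<Rightarrow>\<^sub>0 nat) set" where
  "exponents n e = {m. Poly_Mapping.keys m \<subseteq> {..<n} \<and>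
                       (\<Sum>i\<in>Poly_Mapping.keys m. Poly_Mapping.lookup m i) = e}"

definition forms :: "nat \<Rightarrow> nat \<Rightarrow> 'a::zero mpol set" where
  "forms n d = {f. Poly_Mapping.keys f \<subseteq> exponents n d}"


subsection \<open>Essential rank\<close>

definition subst :: "(nat \<Rightarrow> 'a mpol) \<Rightarrow> 'a mpol \<Rightarrow> 'a::comm_semiring_1 mpol" where
  "subst l g = (\<Sum>m\<in>Poly_Mapping.keys g. Const (Poly_Mapping.lookup g m) *
                  (\<Prod>i\<in>Poly_Mapping.keys m. l i ^ Poly_Mapping.lookup m i))"

text \<open>The subalgebra generated by \<open>l 0, \<dots>, l (r - 1)\<close>: all polynomial expressions in them.\<close>

definition gen_algebra :: "nat \<Rightarrow> (nat \<Rightarrow> 'a mpol) \<Rightarrow> 'a::comm_semiring_1 mpol set" where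
  "gen_algebra r l = {subst l g | g. \<forall>m\<in>Poly_Mapping.keys g. Poly_Mapping.keys m \<subseteq> {..<r}}"

definition ess :: "nat \<Rightarrow> 'a::comm_semiring_1 mpol \<Rightarrow> nat" where
  "ess n f = (LEAST r. \<exists>l. (\<forall>i<r. l i \<in> forms n 1) \<and> f \<in> gen_algebra r l)"

definition d_ess :: "nat \<Rightarrow> 'a::comm_ring_1 mpol \<Rightarrow> 'a mpol \<Rightarrow> nat" where
  "d_ess n f g = ess n (f - g)"

text \<open>The first argument of \<^const>\<open>vec_space.rank\<close> is the number of rows.\<close>

definition d_rk :: "'a::field mat \<Rightarrow> 'a mat \<Rightarrow> nat" where
  "d_rk A B = vec_space.rank (dim_row (A - B)) (A - B)"


subsection \<open>First catalecticant matrix\<close>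

text \<open>
  The difference \<open>m - e\<^sub>i\<close> of exponent vectors is truncated when \<open>x\<^sub>i\<close> does not occur in \<open>m\<close>;
  the coefficient vanishes in that case.
\<close>

definition pdiff :: "nat \<Rightarrow> 'a mpol \<Rightarrow> 'a::comm_semiring_1 mpol" where
  "pdiff i f = (\<Sum>m\<in>Poly_Mapping.keys f.
      Poly_Mapping.single (m - Poly_Mapping.single i 1)
        (of_nat (Poly_Mapping.lookup m i) * Poly_Mapping.lookup f m))"

text \<open>
  The linear order on exponent vectors from \<^theory>\<open>HOL-Library.Poly_Mapping\<close> compares the exponents
  at the smallest index where the two differ, which is the lexicographic order with
  $x_1 > x_2 > \cdots > x_n$. The monomials are listed from the lexicographically largest down,
  so $x_1^e, x_1^{e-1} x_2, \ldots, x_n^e$.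
\<close>

definition lex_exponents :: "nat \<Rightarrow> nat \<Rightarrow> (nat \<Rightarrow>\<^sub>0 nat) list" where
  "lex_exponents n e = rev (sorted_list_of_set (exponents n e))"

definition catalecticant :: "nat \<Rightarrow> nat \<Rightarrow> 'a mpol \<Rightarrow> 'a::comm_semiring_1 mat" where
  "catalecticant n d f = mat n ((n + d - 2) choose (d - 1))
     (\<lambda>(i, j). Poly_Mapping.lookup (pdiff i f) (lex_exponents n (d - 1) ! j))"

lemma bij_betw_exponents:
  "bij_betw (\<lambda>m. map (Poly_Mapping.lookup m) [0..<n]) (exponents n e)
     {xs::nat list. length xs = n \<and> sum_list xs = e}"
proof (rule bij_betw_byWitness[where f' = Poly_Mapping.nth])
  have sum: "(\<Sum>i\<in>Poly_Mapping.keys m. Poly_Mapping.lookup m i) = (\<Sum>i<n. Poly_Mapping.lookup m i)"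
    if "Poly_Mapping.keys m \<subseteq> {..<n}" for m :: "nat \<Rightarrow>\<^sub>0 nat"
    by (rule sum.mono_neutral_left) (use that in \<open>auto simp: in_keys_iff\<close>)
  show "\<forall>m\<in>exponents n e. Poly_Mapping.nth (map (Poly_Mapping.lookup m) [0..<n]) = m"
    by (auto simp: exponents_def nth.rep_eq nth_default_def in_keys_iff subset_iff
             intro!: poly_mapping_eqI)
  show "\<forall>xs\<in>{xs. length xs = n \<and> sum_list xs = e}.
          map (Poly_Mapping.lookup (Poly_Mapping.nth xs)) [0..<n] = xs"
    by (auto simp: nth.rep_eq nth_default_def intro!: nth_equalityI)
  show "(\<lambda>m. map (Poly_Mapping.lookup m) [0..<n]) ` exponents n e
          \<subseteq> {xs. length xs = n \<and> sum_list xs = e}"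
    by (auto simp: exponents_def sum sum_list_sum_nth atLeast0LessThan)
  show "Poly_Mapping.nth ` {xs. length xs = n \<and> sum_list xs = e} \<subseteq> exponents n e"
  proof safe
    fix xs :: "nat list"
    have k: "Poly_Mapping.keys (Poly_Mapping.nth xs) \<subseteq> {..<length xs}"
      unfolding subset_iff in_keys_iff nth.rep_eq nth_default_def by auto
    have "(\<Sum>i<length xs. Poly_Mapping.lookup (Poly_Mapping.nth xs) i) = sum_list xs"
      by (auto simp: nth.rep_eq nth_default_def sum_list_sum_nth atLeast0LessThan)
    moreover have "(\<Sum>i\<in>Poly_Mapping.keys (Poly_Mapping.nth xs). Poly_Mapping.lookup (Poly_Mapping.nth xs) i)
        = (\<Sum>i<length xs. Poly_Mapping.lookup (Poly_Mapping.nth xs) i)"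
      by (rule sum.mono_neutral_left) (use k in \<open>auto simp: in_keys_iff simp del: keys_nth\<close>)
    ultimately show "Poly_Mapping.nth xs \<in> exponents (length xs) (sum_list xs)"
      using k by (simp add: exponents_def)
  qed
qed

lemma card_exponents: "card (exponents n e) = (e + n - 1) choose e"
  using bij_betw_same_card[OF bij_betw_exponents[of n e]] card_length_sum_list[of n e] by simp

lemma finite_exponents: "finite (exponents n e)"
proof -
  have "{xs::nat list. length xs = n \<and> sum_list xs = e} \<subseteq> {xs. set xs \<subseteq> {..e} \<and> length xs = n}"
    by (auto intro: member_le_sum_list)
  then have "finite {xs::nat list. length xs = n \<and> sum_list xs = e}"
    by (rule finite_subset) (rule finite_lists_length_eq, simp)
  then show ?thesis
    using bij_betw_finite[OF bij_betw_exponents[of n e]] by simp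
qed

lemma length_lex_exponents:
  assumes "d \<ge> 1"
  shows "length (lex_exponents n (d - 1)) = (n + d - 2) choose (d - 1)"
proof -
  have "d - 1 + n - 1 = n + d - 2"
    using assms by simp
  then show ?thesis
    by (simp add: lex_exponents_def card_exponents)
qed

lemma keys_pdiff:
  assumes "f \<in> forms n d" and "m \<in> Poly_Mapping.keys (pdiff i f)"
  shows "m \<in> exponents n (d - 1)"
proof -
  have "Poly_Mapping.keys (pdiff i f) \<subseteq> (\<Union>k\<in>Poly_Mapping.keys f.
      Poly_Mapping.keys (Poly_Mapping.single (k - Poly_Mapping.single i 1)
        (of_nat (Poly_Mapping.lookup k i) * Poly_Mapping.lookup f k)))"
    unfolding pdiff_def by (rule keys_sum)
  then obtain k where k: "k \<in> Poly_Mapping.keys f" "m = k - Poly_Mapping.single i 1"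
      "of_nat (Poly_Mapping.lookup k i) * Poly_Mapping.lookup f k \<noteq> 0"
    using assms(2) by (force split: if_splits)
  then have k0: "Poly_Mapping.lookup k i \<noteq> 0"
    by (metis mult_zero_left of_nat_0)
  have ke: "k \<in> exponents n d"
    using assms(1) k(1) by (auto simp: forms_def)
  have kn: "Poly_Mapping.keys k \<subseteq> {..<n}" and i: "i \<in> Poly_Mapping.keys k"
    using ke k0 by (auto simp: exponents_def in_keys_iff)
  have mk: "Poly_Mapping.keys m \<subseteq> Poly_Mapping.keys k"
    by (auto simp: k(2) in_keys_iff lookup_minus)
  have "(\<Sum>j\<in>Poly_Mapping.keys m. Poly_Mapping.lookup m j) = (\<Sum>j\<in>Poly_Mapping.keys k. Poly_Mapping.lookup m j)"
    by (rule sum.mono_neutral_left) (use mk in \<open>auto simp: in_keys_iff\<close>)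
  also have "\<dots> = Poly_Mapping.lookup m i + (\<Sum>j\<in>Poly_Mapping.keys k - {i}. Poly_Mapping.lookup m j)"
    by (rule sum.remove) (use i in auto)
  also have "(\<Sum>j\<in>Poly_Mapping.keys k - {i}. Poly_Mapping.lookup m j) = (\<Sum>j\<in>Poly_Mapping.keys k - {i}. Poly_Mapping.lookup k j)"
    by (rule sum.cong) (auto simp: k(2) lookup_minus lookup_single)
  also have "Poly_Mapping.lookup m i = Poly_Mapping.lookup k i - 1"
    by (simp add: k(2) lookup_minus)
  also have "Poly_Mapping.lookup k i - 1 + (\<Sum>j\<in>Poly_Mapping.keys k - {i}. Poly_Mapping.lookup k j)
      = (\<Sum>j\<in>Poly_Mapping.keys k. Poly_Mapping.lookup k j) - 1"
    using k0 by (subst sum.remove[of _ i]) (use i in auto)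
  finally show ?thesis
    using ke mk kn by (auto simp: exponents_def)
qed

text \<open>The matrix has the characterizing property of the first catalecticant.\<close>

lemma pdiff_eq_catalecticant:
  fixes f :: "'a::comm_semiring_1 mpol"
  assumes "d \<ge> 1" and "f \<in> forms n d" and "i < n"
  shows "pdiff i f = (\<Sum>j < (n + d - 2) choose (d - 1).
           Const (catalecticant n d f $$ (i, j)) * Poly_Mapping.single (lex_exponents n (d - 1) ! j) 1)"
proof -
  let ?L = "lex_exponents n (d - 1)"
  have L: "length ?L = (n + d - 2) choose (d - 1)" "set ?L = exponents n (d - 1)" "distinct ?L"
    using length_lex_exponents[OF assms(1)] finite_exponents[of n "d - 1"]
    by (simp_all add: lex_exponents_def)
  have bij: "bij_betw ((!) ?L) {..<(n + d - 2) choose (d - 1)} (exponents n (d - 1))"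
    by (rule bij_betw_nth) (use L in auto)
  have "pdiff i f = (\<Sum>m\<in>exponents n (d - 1). Poly_Mapping.single m (Poly_Mapping.lookup (pdiff i f) m))"
  proof (rule poly_mapping_eqI)
    fix k
    show "Poly_Mapping.lookup (pdiff i f) k = Poly_Mapping.lookup
        (\<Sum>m\<in>exponents n (d - 1). Poly_Mapping.single m (Poly_Mapping.lookup (pdiff i f) m)) k"
      using keys_pdiff[OF assms(2), of k i]
      by (auto simp: lookup_sum lookup_single when_def finite_exponents in_keys_iff)
  qed
  also have "\<dots> = (\<Sum>j < (n + d - 2) choose (d - 1).
      Poly_Mapping.single (?L ! j) (Poly_Mapping.lookup (pdiff i f) (?L ! j)))"
    by (rule sum.reindex_bij_betw[OF bij, symmetric])
  also have "\<dots> = (\<Sum>j < (n + d - 2) choose (d - 1).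
      Const (catalecticant n d f $$ (i, j)) * Poly_Mapping.single (?L ! j) 1)"
    by (rule sum.cong) (use assms(3) in \<open>auto simp: catalecticant_def Const_def mult_single\<close>)
  finally show ?thesis .
qed

end

theory Submission
  imports Defs
begin

text \<open>
  If \<open>f\<close> lies in the algebra generated by linear forms \<open>l\<^sub>1, \<dots>, l\<^sub>r\<close>, the chain rule writes its gradient
  as a combination of the \<open>r\<close> constant vectors \<open>\<nabla>l\<^sub>k\<close>, so its catalecticant factors through dimension \<open>r\<close>.

  Conversely, let the rows \<open>e\<^sub>1, \<dots>, e\<^sub>r\<close> of the catalecticant span its row space, so that
  \<open>\<partial>\<^sub>j f = \<Sum>\<^sub>k A\<^sub>j\<^sub>k \<partial>\<^bsub>e\<^sub>k\<^esub> f\<close> for all \<open>j\<close>, and put \<open>l\<^sub>k = \<Sum>\<^sub>j A\<^sub>j\<^sub>k x\<^sub>j\<close>. Euler's identity gives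
  \<open>d f = \<Sum>\<^sub>k l\<^sub>k \<partial>\<^bsub>e\<^sub>k\<^esub> f\<close>. Since partial derivatives commute, every \<open>\<partial>\<^sub>i f\<close> satisfies the same linear
  relations, so by induction on the degree it is a polynomial in the \<open>l\<^sub>k\<close>, and hence so is \<open>f\<close>.
\<close>

section \<open>Coefficients, constants and variables\<close>

definition Var :: "nat \<Rightarrow> 'a::comm_semiring_1 mpol" where
  "Var i = Poly_Mapping.single (Poly_Mapping.single i 1) 1"

lemma poly_mapping_eq_sum_single:
  "f = (\<Sum>m\<in>Poly_Mapping.keys f. Poly_Mapping.single m (Poly_Mapping.lookup f m))"
  by (rule poly_mapping_eqI) (auto simp: lookup_sum lookup_single when_def in_keys_iff)

text \<open>An additive property need only be checked on terms \<open>single m c\<close>. This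
  reduces the product rule and the multiplicativity of \<open>subst\<close> to pairs of
  monomials.\<close>

lemma poly_mapping_add_induct [case_names single add]:
  fixes f :: "'k \<Rightarrow>\<^sub>0 'a::comm_monoid_add"
  assumes single: "\<And>m c. P (Poly_Mapping.single m c)"
    and add: "\<And>f g. P f \<Longrightarrow> P g \<Longrightarrow> P (f + g)"
  shows "P f"
proof -
  have "P (\<Sum>m\<in>M. Poly_Mapping.single m (Poly_Mapping.lookup f m))" if "finite M" for M
    using that
  proof (induction M)
    case empty
    \<comment> \<open>The empty sum is a term with coefficient 0 at an arbitrary exponent.\<close>
    then show ?case using single[of undefined 0] by simp
  qed (simp add: single add)
  from this[of "Poly_Mapping.keys f"] show ?thesis
    using poly_mapping_eq_sum_single[of f] by simp
qed

lemma Const_0 [simp]: "Const 0 = 0"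
  by (simp add: Const_def)

lemma Const_1 [simp]: "Const 1 = 1"
  by (simp add: Const_def)

lemma Const_add: "Const (a + b) = Const a + Const b"
  by (simp add: Const_def single_add)

lemma Const_sum: "Const (\<Sum>x\<in>S. f x) = (\<Sum>x\<in>S. Const (f x))"
  by (induction S rule: infinite_finite_induct) (simp_all add: Const_add)

lemma Const_mult: "Const (a * b) = Const a * Const b"
  by (simp add: Const_def mult_single)

lemma lookup_Const_times:
  fixes f :: "'a::comm_semiring_1 mpol"
  shows "Poly_Mapping.lookup (Const c * f) m = c * Poly_Mapping.lookup f m"
  by (induction f rule: poly_mapping_add_induct)
    (auto simp: Const_def mult_single lookup_single when_def lookup_add distrib_left)

lemma lookup_Var_times:
  fixes f :: "'a::comm_semiring_1 mpol"
  shows "Poly_Mapping.lookup (Var i * f) m =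
    (if Poly_Mapping.lookup m i = 0 then 0 else Poly_Mapping.lookup f (m - Poly_Mapping.single i 1))"
proof (induction f rule: poly_mapping_add_induct)
  case (single k c)
  have "Poly_Mapping.single i 1 + k = m \<longleftrightarrow>
      Poly_Mapping.lookup m i \<noteq> 0 \<and> k = m - Poly_Mapping.single i 1"
  proof
    assume r: "Poly_Mapping.lookup m i \<noteq> 0 \<and> k = m - Poly_Mapping.single i 1"
    show "Poly_Mapping.single i 1 + k = m"
      by (rule poly_mapping_eqI) (use r in \<open>auto simp: lookup_add lookup_minus lookup_single when_def\<close>)
  qed (auto simp: lookup_add)
  then show ?case
    by (auto simp: Var_def mult_single lookup_single when_def)
qed (auto simp: lookup_add distrib_left)

section \<open>Partial derivatives\<close>

text \<open>Read off at the target exponent \<open>m\<close>, the coefficient involves no truncated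
  subtraction, so linearity and commutation of derivatives become comparisons of
  coefficients.\<close>

lemma lookup_pdiff:
  fixes f :: "'a::comm_semiring_1 mpol"
  shows "Poly_Mapping.lookup (pdiff i f) m =
    of_nat (Poly_Mapping.lookup m i + 1) * Poly_Mapping.lookup f (m + Poly_Mapping.single i 1)"
proof -
  let ?k = "m + Poly_Mapping.single i 1"
  \<comment> \<open>Lowering the exponent of variable \<open>i\<close> can be undone only if that
    exponent is positive; terms where it is 0 carry the factor 0.\<close>
  have eq: "k - Poly_Mapping.single i 1 = m \<longleftrightarrow> k = ?k" if "Poly_Mapping.lookup k i \<noteq> 0" for k
  proof -
    have "k - Poly_Mapping.single i 1 + Poly_Mapping.single i 1 = k"
      by (rule poly_mapping_eqI) (use that in \<open>auto simp: lookup_add lookup_minus lookup_single when_def\<close>)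
    then show ?thesis by (metis add_diff_cancel_right')
  qed
  have "Poly_Mapping.lookup (pdiff i f) m = (\<Sum>k\<in>Poly_Mapping.keys f. if k = ?k
      then of_nat (Poly_Mapping.lookup k i) * Poly_Mapping.lookup f k else 0)"
    unfolding pdiff_def lookup_sum
  proof (rule sum.cong)
    fix k
    show "Poly_Mapping.lookup (Poly_Mapping.single (k - Poly_Mapping.single i 1)
          (of_nat (Poly_Mapping.lookup k i) * Poly_Mapping.lookup f k)) m =
        (if k = ?k then of_nat (Poly_Mapping.lookup k i) * Poly_Mapping.lookup f k else 0)"
      using eq[of k] by (cases "Poly_Mapping.lookup k i = 0") (auto simp: lookup_single when_def lookup_add)
  qed simp
  also have "\<dots> = of_nat (Poly_Mapping.lookup m i + 1) * Poly_Mapping.lookup f ?k"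
    by (auto simp: in_keys_iff lookup_add)
  finally show ?thesis .
qed

lemma pdiff_add: "pdiff i (f + g) = pdiff i f + pdiff i (g :: 'a::comm_semiring_1 mpol)"
  by (rule poly_mapping_eqI) (simp add: lookup_pdiff lookup_add distrib_left)

lemma pdiff_0 [simp]: "pdiff i 0 = 0"
  by (simp add: pdiff_def)

lemma pdiff_sum: "pdiff i (\<Sum>x\<in>S. f x) = (\<Sum>x\<in>S. pdiff i (f x :: 'a::comm_semiring_1 mpol))"
  by (induction S rule: infinite_finite_induct) (simp_all add: pdiff_add)

lemma pdiff_single:
  "pdiff i (Poly_Mapping.single m c) = Poly_Mapping.single (m - Poly_Mapping.single i 1)
     (of_nat (Poly_Mapping.lookup m i) * (c :: 'a::comm_semiring_1))"
  by (simp add: pdiff_def)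

lemma pdiff_Const_times: "pdiff i (Const c * f) = Const c * pdiff i (f :: 'a::comm_semiring_1 mpol)"
  by (rule poly_mapping_eqI) (simp add: lookup_pdiff lookup_Const_times mult.left_commute)

lemma pdiff_Const [simp]: "pdiff i (Const (c :: 'a::comm_semiring_1)) = 0"
  by (simp add: Const_def pdiff_single)

lemma pdiff_commute: "pdiff i (pdiff j f) = pdiff j (pdiff i (f :: 'a::comm_semiring_1 mpol))"
  by (rule poly_mapping_eqI) (simp add: lookup_pdiff lookup_add lookup_single ac_simps when_def)

text \<open>Both sides are additive in \<open>f\<close> and in \<open>g\<close>, which leaves the
  case of two monomials.\<close>

lemma pdiff_mult:
  fixes f g :: "'a::comm_semiring_1 mpol"
  shows "pdiff i (f * g) = pdiff i f * g + f * pdiff i g"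
proof (induction f rule: poly_mapping_add_induct)
  case (single m a)
  show ?case
  proof (induction g rule: poly_mapping_add_induct)
    case (single k b)
    let ?e = "Poly_Mapping.single i (1::nat)"
    \<comment> \<open>The truncated subtraction is moved onto a factor only if variable
      \<open>i\<close> occurs there; otherwise the corresponding summand has coefficient 0.\<close>
    have m: "m + k - ?e = m - ?e + k" if "Poly_Mapping.lookup m i \<noteq> 0"
      by (rule poly_mapping_eqI) (use that in \<open>auto simp: lookup_add lookup_minus lookup_single when_def\<close>)
    have k: "m + k - ?e = m + (k - ?e)" if "Poly_Mapping.lookup k i \<noteq> 0"
      by (rule poly_mapping_eqI) (use that in \<open>auto simp: lookup_add lookup_minus lookup_single when_def\<close>)
    have "pdiff i (Poly_Mapping.single m a * Poly_Mapping.single k b) =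
        Poly_Mapping.single (m + k - ?e) (of_nat (Poly_Mapping.lookup m i) * a * b) +
        Poly_Mapping.single (m + k - ?e) (a * (of_nat (Poly_Mapping.lookup k i) * b))"
      by (simp add: pdiff_single mult_single lookup_add algebra_simps flip: single_add)
    also have "Poly_Mapping.single (m + k - ?e) (of_nat (Poly_Mapping.lookup m i) * a * b) =
        pdiff i (Poly_Mapping.single m a) * Poly_Mapping.single k b"
      using m by (cases "Poly_Mapping.lookup m i = 0") (auto simp: pdiff_single mult_single)
    also have "Poly_Mapping.single (m + k - ?e) (a * (of_nat (Poly_Mapping.lookup k i) * b)) =
        Poly_Mapping.single m a * pdiff i (Poly_Mapping.single k b)"
      using k by (cases "Poly_Mapping.lookup k i = 0") (auto simp: pdiff_single mult_single)
    finally show ?case .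
  qed (simp add: pdiff_add algebra_simps)
qed (simp add: pdiff_add algebra_simps)

section \<open>Forms and Euler's identity\<close>

lemma exponents_sum:
  assumes "m \<in> exponents n d"
  shows "(\<Sum>i<n. Poly_Mapping.lookup m i) = d"
proof -
  have "(\<Sum>i\<in>Poly_Mapping.keys m. Poly_Mapping.lookup m i) = (\<Sum>i<n. Poly_Mapping.lookup m i)"
    by (rule sum.mono_neutral_left) (use assms in \<open>auto simp: exponents_def in_keys_iff\<close>)
  then show ?thesis using assms by (simp add: exponents_def)
qed

text \<open>Multiplying by \<open>Var i\<close> after \<open>pdiff i\<close> restores the exponent
  \<open>m\<close> and scales its coefficient by the exponent of variable \<open>i\<close>. On the
  support of \<open>f\<close> these exponents add up to \<open>d\<close>.\<close>

lemma euler: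
  fixes f :: "'a::comm_semiring_1 mpol"
  assumes "f \<in> forms n d"
  shows "(\<Sum>i<n. Var i * pdiff i f) = Const (of_nat d) * f"
proof (rule poly_mapping_eqI)
  fix m
  have "Poly_Mapping.lookup (Var i * pdiff i f) m = of_nat (Poly_Mapping.lookup m i) * Poly_Mapping.lookup f m"
    for i
  proof (cases "Poly_Mapping.lookup m i = 0")
    case False
    then have "m - Poly_Mapping.single i 1 + Poly_Mapping.single i 1 = m"
      by (intro poly_mapping_eqI) (auto simp: lookup_add lookup_minus lookup_single when_def)
    then show ?thesis
      using False by (simp add: lookup_Var_times lookup_pdiff lookup_minus)
  qed (simp add: lookup_Var_times)
  then have "Poly_Mapping.lookup (\<Sum>i<n. Var i * pdiff i f) m =
      of_nat (\<Sum>i<n. Poly_Mapping.lookup m i) * Poly_Mapping.lookup f m"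
    by (simp add: lookup_sum sum_distrib_right)
  also have "\<dots> = of_nat d * Poly_Mapping.lookup f m"
    using assms exponents_sum[of m n d]
    by (cases "m \<in> Poly_Mapping.keys f") (auto simp: forms_def in_keys_iff simp del: of_nat_sum)
  finally show "Poly_Mapping.lookup (\<Sum>i<n. Var i * pdiff i f) m = Poly_Mapping.lookup (Const (of_nat d) * f) m"
    by (simp add: lookup_Const_times)
qed

lemma pdiff_in_forms: "f \<in> forms n d \<Longrightarrow> pdiff i f \<in> forms n (d - 1)"
  using keys_pdiff[of f n d] by (auto simp: forms_def)

lemma forms_diff:
  fixes f g :: "'a::ring_1 mpol"
  assumes "f \<in> forms n d" "g \<in> forms n d"
  shows "f - g \<in> forms n d"
proof -
  have "Poly_Mapping.lookup (f - g) m = 0" if "m \<notin> exponents n d" for m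
  proof -
    have "m \<notin> Poly_Mapping.keys f" "m \<notin> Poly_Mapping.keys g"
      using assms that by (auto simp: forms_def)
    then show ?thesis by (simp add: lookup_minus in_keys_iff)
  qed
  then show ?thesis by (auto simp: forms_def in_keys_iff)
qed

lemma exponents_0: "exponents n 0 = {0}"
  by (auto simp: exponents_def in_keys_iff intro!: poly_mapping_eqI)

text \<open>Serves as the base case of the induction on the degree and shows that linear forms have
  constant derivatives.\<close>

lemma forms_0:
  assumes "f \<in> forms n 0"
  shows "f = Const (Poly_Mapping.lookup f 0)"
proof (rule poly_mapping_eqI)
  fix m show "Poly_Mapping.lookup f m = Poly_Mapping.lookup (Const (Poly_Mapping.lookup f 0)) m"
    using assms by (cases "m = 0") (auto simp: forms_def exponents_0 Const_def lookup_single when_def in_keys_iff)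
qed

lemma Const_times_Var: "Const c * Var j = Poly_Mapping.single (Poly_Mapping.single j 1) (c::'a::comm_semiring_1)"
  by (simp add: Const_def Var_def mult_single)

lemma linear_form_in_forms:
  "(\<Sum>j<n. Const (a j) * Var j :: 'a::comm_semiring_1 mpol) \<in> forms n 1"
proof -
  have "Poly_Mapping.single j (1::nat) \<in> exponents n 1" if "j < n" for j
    using that by (simp add: exponents_def)
  then show ?thesis
    unfolding forms_def mem_Collect_eq Const_times_Var
    by (intro subset_trans[OF keys_sum]) (force split: if_splits)
qed

section \<open>Substitution and generated algebras\<close>

definition monomial_value :: "(nat \<Rightarrow> 'a mpol) \<Rightarrow> (nat \<Rightarrow>\<^sub>0 nat) \<Rightarrow> 'a::comm_semiring_1 mpol" where
  "monomial_value l m = (\<Prod>i\<in>Poly_Mapping.keys m. l i ^ Poly_Mapping.lookup m i)"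

text \<open>A larger index set allows polynomials with different supports to be summed over one
  common set.\<close>

lemma subst_superset:
  fixes g :: "'a::comm_semiring_1 mpol"
  assumes "finite M" "Poly_Mapping.keys g \<subseteq> M"
  shows "subst l g = (\<Sum>m\<in>M. Const (Poly_Mapping.lookup g m) * monomial_value l m)"
  unfolding subst_def monomial_value_def
  by (rule sum.mono_neutral_left) (use assms in \<open>auto simp: in_keys_iff\<close>)

lemma monomial_value_superset:
  assumes "finite S" "Poly_Mapping.keys m \<subseteq> S"
  shows "monomial_value l m = (\<Prod>i\<in>S. l i ^ Poly_Mapping.lookup m i)"
  unfolding monomial_value_def
  by (rule prod.mono_neutral_left) (use assms in \<open>auto simp: in_keys_iff\<close>)

lemma monomial_value_add: "monomial_value l (m + k) = monomial_value l m * monomial_value l k"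
proof -
  let ?S = "Poly_Mapping.keys m \<union> Poly_Mapping.keys k"
  show ?thesis
    using Poly_Mapping.keys_add[of m k]
    by (simp add: monomial_value_superset[of ?S] lookup_add power_add prod.distrib)
qed

lemma subst_add:
  fixes f g :: "'a::comm_semiring_1 mpol"
  shows "subst l (f + g) = subst l f + subst l g"
proof -
  let ?M = "Poly_Mapping.keys f \<union> Poly_Mapping.keys g"
  show ?thesis
    using Poly_Mapping.keys_add[of f g]
    by (simp add: subst_superset[of ?M] lookup_add Const_add distrib_right sum.distrib)
qed

lemma subst_single: "subst l (Poly_Mapping.single m c) = Const c * monomial_value l m"
  by (simp add: subst_def monomial_value_def)

lemma subst_mult:
  fixes f g :: "'a::comm_semiring_1 mpol"
  shows "subst l (f * g) = subst l f * subst l g"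
proof (induction f rule: poly_mapping_add_induct)
  case (single m a)
  show ?case
    by (induction g rule: poly_mapping_add_induct)
      (simp_all add: mult_single subst_single subst_add monomial_value_add Const_mult algebra_simps)
qed (simp add: subst_add distrib_right)

lemma gen_algebra_add: "f \<in> gen_algebra r l \<Longrightarrow> g \<in> gen_algebra r l \<Longrightarrow> f + g \<in> gen_algebra r l"
proof -
  assume "f \<in> gen_algebra r l" "g \<in> gen_algebra r l"
  then obtain p q where p: "f = subst l p" "\<forall>m\<in>Poly_Mapping.keys p. Poly_Mapping.keys m \<subseteq> {..<r}"
    and q: "g = subst l q" "\<forall>m\<in>Poly_Mapping.keys q. Poly_Mapping.keys m \<subseteq> {..<r}"
    by (auto simp: gen_algebra_def)
  have "\<forall>m\<in>Poly_Mapping.keys (p + q). Poly_Mapping.keys m \<subseteq> {..<r}"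
    using p(2) q(2) Poly_Mapping.keys_add[of p q] by blast
  then show ?thesis
    unfolding gen_algebra_def using p(1) q(1) by (auto simp flip: subst_add)
qed

lemma gen_algebra_mult: 
  assumes "f \<in> gen_algebra r l" "g \<in> gen_algebra r l"
  shows "f * g \<in> gen_algebra r l"
proof -
  from assms obtain p q where p: "f = subst l p" "\<forall>m\<in>Poly_Mapping.keys p. Poly_Mapping.keys m \<subseteq> {..<r}"
    and q: "g = subst l q" "\<forall>m\<in>Poly_Mapping.keys q. Poly_Mapping.keys m \<subseteq> {..<r}"
    by (auto simp: gen_algebra_def)
  have "Poly_Mapping.keys m \<subseteq> {..<r}" if m: "m \<in> Poly_Mapping.keys (p * q)" for m
  proof -
    obtain a b where "m = a + b" "a \<in> Poly_Mapping.keys p" "b \<in> Poly_Mapping.keys q"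
      using subsetD[OF keys_mult m] by auto
    then show ?thesis
      using p(2) q(2) Poly_Mapping.keys_add[of a b] by blast
  qed
  then show ?thesis unfolding gen_algebra_def using p(1) q(1) by (auto simp flip: subst_mult)
qed

lemma Const_in_gen_algebra: "Const c \<in> gen_algebra r l"
proof -
  have "Const c = subst l (Const c)" by (simp add: Const_def subst_single monomial_value_def)
  then show ?thesis unfolding gen_algebra_def by (auto simp: Const_def split: if_splits intro!: exI[of _ "Const c"])
qed

lemma gen_in_gen_algebra:
  assumes "k < r" shows "l k \<in> gen_algebra r l"
proof -
  have "l k = subst l (Var k)" by (simp add: Var_def subst_single monomial_value_def)
  then show ?thesis unfolding gen_algebra_def using assms by (auto simp: Var_def intro!: exI[of _ "Var k"])
qed

lemma gen_algebra_sum: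
  "(\<And>x. x \<in> S \<Longrightarrow> f x \<in> gen_algebra r l) \<Longrightarrow> (\<Sum>x\<in>S. f x) \<in> gen_algebra r l"
  using Const_in_gen_algebra[of 0 r l]
  by (induction S rule: infinite_finite_induct) (auto intro: gen_algebra_add)

text \<open>Every element is a finite sum of constants times products of powers of generators; empty
  sums and products are covered by \<open>Const 0\<close> and \<open>Const 1\<close>.\<close>

lemma gen_algebra_induct [consumes 1, case_names Const gen add mult]:
  assumes "f \<in> gen_algebra r l"
    and "\<And>c. P (Const c)" and "\<And>k. k < r \<Longrightarrow> P (l k)"
    and "\<And>f g. P f \<Longrightarrow> P g \<Longrightarrow> P (f + g)" and "\<And>f g. P f \<Longrightarrow> P g \<Longrightarrow> P (f * g)"
  shows "P f"
proof -
  have P1: "P 1" and P0: "P 0" using assms(2)[of 1] assms(2)[of 0] by simp_all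
  have pw: "P (l k ^ e)" if "k < r" for k e
    by (induction e) (use that assms(3,5) P1 in auto)
  have pr: "P (\<Prod>i\<in>S. l i ^ e i)" if "S \<subseteq> {..<r}" for S e
    using that by (induction S rule: infinite_finite_induct) (use P1 pw assms(5) in auto)
  have su: "P (\<Sum>m\<in>S. h m)" if "\<And>m. m \<in> S \<Longrightarrow> P (h m)" for S and h :: "(nat \<Rightarrow>\<^sub>0 nat) \<Rightarrow> 'a mpol"
    using that by (induction S rule: infinite_finite_induct) (use P0 assms(4) in auto)
  from assms(1) show ?thesis
    unfolding gen_algebra_def subst_def by (force intro: su assms(2,5) pr)
qed

section \<open>Generated algebras and linear relations among derivatives\<close>

text \<open>The chain rule with the outer derivatives left implicit: \<open>h k\<close> stands for
  the derivative of the outer polynomial in argument \<open>k\<close>. What matters is that one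
  \<open>h\<close> serves every direction \<open>i\<close>.\<close>

lemma gradient_gen_algebra:
  fixes l :: "nat \<Rightarrow> 'a::comm_semiring_1 mpol"
  assumes "f \<in> gen_algebra r l"
  shows "\<exists>h. \<forall>i. pdiff i f = (\<Sum>k<r. pdiff i (l k) * h k)"
  using assms
proof (induction rule: gen_algebra_induct)
  case (Const c)
  show ?case by (rule exI[of _ "\<lambda>_. 0"]) simp
next
  case (gen k)
  show ?case
    by (rule exI[of _ "\<lambda>j. if j = k then 1 else 0"]) (use gen in \<open>simp add: if_distrib cong: if_cong\<close>)
next
  case (add f g)
  obtain a where a: "\<And>i. pdiff i f = (\<Sum>k<r. pdiff i (l k) * a k)"
    using add.IH(1) by blast
  obtain b where b: "\<And>i. pdiff i g = (\<Sum>k<r. pdiff i (l k) * b k)"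
    using add.IH(2) by blast
  show ?case
    by (intro exI[of _ "\<lambda>k. a k + b k"]) (simp add: pdiff_add a b distrib_left sum.distrib)
next
  case (mult f g)
  obtain a where a: "\<And>i. pdiff i f = (\<Sum>k<r. pdiff i (l k) * a k)"
    using mult.IH(1) by blast
  obtain b where b: "\<And>i. pdiff i g = (\<Sum>k<r. pdiff i (l k) * b k)"
    using mult.IH(2) by blast
  show ?case
    by (intro exI[of _ "\<lambda>k. a k * g + f * b k"])
      (simp add: pdiff_mult a b distrib_left sum.distrib sum_distrib_left sum_distrib_right ac_simps)
qed

text \<open>\<open>A\<close> and \<open>e\<close> stay fixed in the induction while \<open>f\<close>
  is replaced by its derivatives. Euler's identity is divided by each positive degree up to
  \<open>d\<close>, whence the assumption on all \<open>of_nat j\<close>.\<close>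

lemma form_in_gen_algebra:
  fixes f :: "'a::field mpol"
  assumes "f \<in> forms n d"
    and "\<And>j. 0 < j \<Longrightarrow> j \<le> d \<Longrightarrow> (of_nat j :: 'a) \<noteq> 0"
    and "\<And>j. j < n \<Longrightarrow> pdiff j f = (\<Sum>k<r. Const (A j k) * pdiff (e k) f)"
  shows "f \<in> gen_algebra r (\<lambda>k. \<Sum>j<n. Const (A j k) * Var j)"
  using assms
proof (induction d arbitrary: f)
  case 0
  show ?case
    by (subst forms_0[OF "0.prems"(1)]) (rule Const_in_gen_algebra)
next
  case (Suc d)
  let ?l = "\<lambda>k. \<Sum>j<n. Const (A j k) * Var j"
  have IH: "pdiff i f \<in> gen_algebra r ?l" for i
  proof (rule Suc.IH)
    show "pdiff i f \<in> forms n d" using pdiff_in_forms[OF Suc.prems(1), of i] by simp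
    show "(of_nat j :: 'a) \<noteq> 0" if "0 < j" "j \<le> d" for j using Suc.prems(2) that by simp
    \<comment> \<open>Apply \<open>pdiff i\<close> to the relation for \<open>f\<close>: derivatives
      commute and the \<open>A j k\<close> are constants.\<close>
    show "pdiff j (pdiff i f) = (\<Sum>k<r. Const (A j k) * pdiff (e k) (pdiff i f))" if "j < n" for j
      by (simp add: pdiff_commute[of _ i] Suc.prems(3)[OF that] pdiff_sum pdiff_Const_times)
  qed
  have nz: "(of_nat (Suc d) :: 'a) \<noteq> 0" using Suc.prems(2) by blast
  \<comment> \<open>Euler's identity in degree \<open>Suc d\<close>, divided by that degree,
    expresses \<open>f\<close> through its derivatives.\<close>
  have "f = Const (inverse (of_nat (Suc d)) * of_nat (Suc d)) * f"
    using nz by (simp del: of_nat_Suc)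
  also have "\<dots> = Const (inverse (of_nat (Suc d))) * (\<Sum>j<n. Var j * pdiff j f)"
    by (simp add: euler[OF Suc.prems(1)] Const_mult ac_simps)
  also have "(\<Sum>j<n. Var j * pdiff j f) = (\<Sum>j<n. \<Sum>k<r. Const (A j k) * Var j * pdiff (e k) f)"
    by (simp add: Suc.prems(3) sum_distrib_left ac_simps)
  also have "\<dots> = (\<Sum>k<r. ?l k * pdiff (e k) f)"
    by (subst sum.swap) (simp add: sum_distrib_right)
  also have "Const (inverse (of_nat (Suc d))) * \<dots> \<in> gen_algebra r ?l"
    by (intro gen_algebra_mult gen_algebra_sum Const_in_gen_algebra gen_in_gen_algebra[of _ _ ?l] IH) auto
  finally show ?case .
qed

section \<open>Matrix rank\<close>

text \<open>Take a maximal independent set of columns: adding any other column makes it dependent,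
  so that column lies in the span.\<close>

lemma (in vec_space) rank_eq_card_cols_basis:
  assumes A: "A \<in> carrier_mat n nc"
  obtains U where "U \<subseteq> set (cols A)" "lin_indpt U" "card U = rank A" "set (cols A) \<subseteq> span U"
proof -
  let ?P = "\<lambda>T. T \<subseteq> set (cols A) \<and> lin_indpt T"
  have carr: "set (cols A) \<subseteq> carrier_vec n"
    using cols_dim[of A] A by simp
  have "?P {}"
    by (simp add: lin_dep_def)
  then obtain U where U: "maximal U ?P"
    using maximal_exists_superset[of "set (cols A)" ?P "{}"] by auto
  then have U1: "U \<subseteq> set (cols A)" "lin_indpt U"
    and max: "\<And>T. T \<subseteq> set (cols A) \<Longrightarrow> lin_indpt T \<Longrightarrow> U \<subseteq> T \<Longrightarrow> T = U"
    unfolding maximal_def by auto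
  have "v \<in> span U" if v: "v \<in> set (cols A)" for v
  proof (cases "v \<in> U")
    case True
    then show ?thesis
      using in_own_span[of U] U1 carr by auto
  next
    case False
    then have "lin_dep (U \<union> {v})"
      using max[of "U \<union> {v}"] U1 v by auto
    then show ?thesis
      using lin_dep_iff_in_span[of U v] U1 v carr False by auto
  qed
  then show ?thesis
    using that[OF U1] rank_card_indpt[OF A U] by auto
qed

text \<open>The columns of the product are combinations of the at most \<open>r\<close> distinct
  columns of \<open>A\<close>; Steinitz exchange bounds any independent set among them.\<close>

lemma (in vec_space) rank_mult_le:
  assumes A: "A \<in> carrier_mat n r" and B: "B \<in> carrier_mat r nc"
  shows "rank (A * B) \<le> r"
proof -
  have AB: "A * B \<in> carrier_mat n nc"
    using A B by simp
  obtain U where U: "U \<subseteq> set (cols (A * B))" "lin_indpt U" "card U = rank (A * B)"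
    by (rule rank_eq_card_cols_basis[OF AB])
  have carr: "set (cols A) \<subseteq> carrier_vec n"
    using cols_dim[of A] A by simp
  have "set (cols (A * B)) \<subseteq> span (set (cols A))"
  proof
    fix v assume "v \<in> set (cols (A * B))"
    then obtain j where "j < nc" "v = col (A * B) j"
      using AB by (auto simp: cols_def)
    then have "v = A *\<^sub>v col B j" "col B j \<in> carrier_vec r"
      using A B by (auto simp: col_mult2)
    then have "v \<in> col_space A"
      unfolding col_space_eq[OF A] using A by auto
    then show "v \<in> span (set (cols A))"
      by (simp add: col_space_def)
  qed
  then have "card U \<le> card (set (cols A))"
    using replacement[of U "set (cols A)"] U carr finite_subset[OF U(1)] by force
  also have "\<dots> \<le> r"
    using card_length[of "cols A"] A by simp
  finally show ?thesis
    using U by simp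
qed

text \<open>Coordinate form of the column basis: \<open>e\<close> lists indices of basis columns,
  and \<open>X j\<close> holds the coordinates of column \<open>j\<close>.\<close>

lemma (in vec_space) cols_spanned_by_rank_cols:
  assumes A: "A \<in> carrier_mat n nc"
  shows "\<exists>e X. (\<forall>k<rank A. e k < nc) \<and>
    (\<forall>i<n. \<forall>j<nc. A $$ (i, j) = (\<Sum>k<rank A. X j k * A $$ (i, e k)))"
proof -
  obtain U where U: "U \<subseteq> set (cols A)" "card U = rank A" "set (cols A) \<subseteq> span U"
    by (rule rank_eq_card_cols_basis[OF A])
  have finU: "finite U" and carr: "U \<subseteq> carrier_vec n"
    using finite_subset[OF U(1)] U(1) cols_dim[of A] A by auto
  obtain us where us: "bij_betw us {..<rank A} U"
    using ex_bij_betw_nat_finite[OF finU] U(2) by (auto simp: atLeast0LessThan)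
  have "\<exists>j<nc. us k = col A j" if "k < rank A" for k
  proof -
    have "us k \<in> set (cols A)"
      using bij_betwE[OF us] that U(1) by auto
    then show ?thesis
      using A by (auto simp: cols_def)
  qed
  then obtain e where e: "\<And>k. k < rank A \<Longrightarrow> e k < nc \<and> us k = col A (e k)"
    by metis
  have "\<exists>x. \<forall>i<n. A $$ (i, j) = (\<Sum>k<rank A. x k * A $$ (i, e k))" if j: "j < nc" for j
  proof -
    have "col A j \<in> span U"
      using U(3) j A by (auto simp: cols_def)
    then have "\<exists>a. lincomb a U = col A j"
      using finite_in_span[OF finU] carr by auto
    then obtain a where a: "lincomb a U = col A j" ..
    have "A $$ (i, j) = (\<Sum>k<rank A. a (us k) * A $$ (i, e k))" if i: "i < n" for i
    proof -
      have "A $$ (i, j) = lincomb a U $ i"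
        using A i j by (simp add: a)
      also have "\<dots> = (\<Sum>x\<in>U. a x * x $ i)"
        using lincomb_index[OF i carr] .
      also have "\<dots> = (\<Sum>k<rank A. a (us k) * us k $ i)"
        by (rule sum.reindex_bij_betw[OF us, symmetric])
      also have "\<dots> = (\<Sum>k<rank A. a (us k) * A $$ (i, e k))"
        by (rule sum.cong) (use e A i in auto)
      finally show ?thesis .
    qed
    then show ?thesis
      by (intro exI[of _ "\<lambda>k. a (us k)"]) blast
  qed
  \<comment> \<open>With \<open>j < nc\<close> under the existential quantifier the statement is
    total in \<open>j\<close>, as \<open>choice\<close> requires.\<close>
  then have "\<forall>j. \<exists>x. j < nc \<longrightarrow> (\<forall>i<n. A $$ (i, j) = (\<Sum>k<rank A. x k * A $$ (i, e k)))"
    by blast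
  then obtain X where
    X: "\<forall>j. j < nc \<longrightarrow> (\<forall>i<n. A $$ (i, j) = (\<Sum>k<rank A. X j k * A $$ (i, e k)))"
    by (rule choice[THEN exE])
  have "\<forall>k<rank A. e k < nc"
    using e by simp
  moreover have "\<forall>i<n. \<forall>j<nc. A $$ (i, j) = (\<Sum>k<rank A. X j k * A $$ (i, e k))"
    using X by blast
  ultimately show ?thesis
    by (intro exI[of _ e] exI[of _ X] conjI)
qed

text \<open>Rank factorization: \<open>A\<close> is its basis columns times the coordinates, so its
  transpose is also a product whose inner dimension is the rank of \<open>A\<close>.\<close>

lemma rank_transpose_le:
  fixes A :: "'a::field mat"
  assumes A: "A \<in> carrier_mat nr nc"
  shows "vec_space.rank nc A\<^sup>T \<le> vec_space.rank nr A"
proof -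
  let ?r = "vec_space.rank nr A"
  obtain e X where "\<forall>k<?r. e k < nc"
    and eX: "\<forall>i<nr. \<forall>j<nc. A $$ (i, j) = (\<Sum>k<?r. X j k * A $$ (i, e k))"
    using vec_space.cols_spanned_by_rank_cols[OF A] by (elim exE conjE) (rule that)
  have "A\<^sup>T = mat nc ?r (\<lambda>(j, k). X j k) * mat ?r nr (\<lambda>(k, i). A $$ (i, e k))"
    by (rule eq_matI) (use A in \<open>auto simp: eX scalar_prod_def atLeast0LessThan\<close>)
  then show ?thesis
    by (simp only: vec_space.rank_mult_le[OF mat_carrier mat_carrier])
qed

lemma rank_transpose:
  fixes A :: "'a::field mat"
  assumes A: "A \<in> carrier_mat nr nc"
  shows "vec_space.rank nc A\<^sup>T = vec_space.rank nr A"
  using rank_transpose_le[OF A] rank_transpose_le[of "A\<^sup>T" nc nr] A by simp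

section \<open>The catalecticant: linearity, rank and injectivity\<close>

lemma catalecticant_carrier:
  "catalecticant n d f \<in> carrier_mat n ((n + d - 2) choose (d - 1))"
  by (simp add: catalecticant_def)

lemma catalecticant_add:
  "catalecticant n d (f + g) = catalecticant n d f + catalecticant n d (g :: 'a::comm_semiring_1 mpol)"
  by (rule eq_matI) (auto simp: catalecticant_def pdiff_add lookup_add)

lemma catalecticant_diff:
  "catalecticant n d (f - g) = catalecticant n d f - catalecticant n d (g :: 'a::comm_ring_1 mpol)"
  by (rule eq_matI) (auto simp: catalecticant_def lookup_pdiff lookup_minus right_diff_distrib)

lemma catalecticant_Const_times:
  "catalecticant n d (Const c * f) = c \<cdot>\<^sub>m catalecticant n d (f :: 'a::comm_semiring_1 mpol)"
  by (rule eq_matI) (auto simp: catalecticant_def pdiff_Const_times lookup_Const_times)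

text \<open>A characteristic above \<open>d\<close> cannot divide a positive \<open>j\<close> up to
  \<open>d\<close>, and 0 divides only 0.\<close>

lemma of_nat_neq_0_of_CHAR:
  assumes "CHAR('a::semiring_1) = 0 \<or> CHAR('a) > d" and "0 < j" and "j \<le> d"
  shows "(of_nat j :: 'a) \<noteq> 0"
  using assms by (auto simp: of_nat_eq_0_iff_char_dvd dest: dvd_imp_le)

lemma rank_catalecticant_le:
  fixes f :: "'a::field mpol"
  assumes "\<And>k. k < r \<Longrightarrow> l k \<in> forms n 1" and "f \<in> gen_algebra r l"
  shows "vec_space.rank n (catalecticant n d f) \<le> r"
proof -
  let ?N = "(n + d - 2) choose (d - 1)"
  obtain h where h: "\<And>i. pdiff i f = (\<Sum>k<r. pdiff i (l k) * h k)"
    using gradient_gen_algebra[OF assms(2)] by blast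
  \<comment> \<open>Derivatives of linear forms have degree 0, so each equals its constant term
    \<open>?a i k\<close>.\<close>
  let ?a = "\<lambda>i k. Poly_Mapping.lookup (pdiff i (l k)) 0"
  let ?A = "mat n r (\<lambda>(i, k). ?a i k)"
  \<comment> \<open>The \<open>h k\<close> need not be homogeneous; only their coefficients in
    degree \<open>d - 1\<close> enter \<open>?B\<close>.\<close>
  let ?B = "mat r ?N (\<lambda>(k, j). Poly_Mapping.lookup (h k) (lex_exponents n (d - 1) ! j))"
  have "pdiff i (l k) = Const (?a i k)" if "k < r" for i k
    using pdiff_in_forms[OF assms(1)[OF that]] by (intro forms_0) simp
  then have "pdiff i f = (\<Sum>k<r. Const (?a i k) * h k)" for i
    unfolding h by (intro sum.cong) auto
  then have "catalecticant n d f = ?A * ?B"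
    by (intro eq_matI)
      (auto simp: catalecticant_def scalar_prod_def atLeast0LessThan lookup_sum lookup_Const_times)
  then show ?thesis
    by (simp only: vec_space.rank_mult_le[OF mat_carrier mat_carrier])
qed

lemma rank_catalecticant_eq_ess:
  fixes f :: "'a::field mpol"
  assumes d: "d \<ge> 1" and char: "CHAR('a) = 0 \<or> CHAR('a) > d" and f: "f \<in> forms n d"
  shows "vec_space.rank n (catalecticant n d f) = ess n f"
proof -
  let ?N = "(n + d - 2) choose (d - 1)"
  let ?C = "catalecticant n d f"
  let ?r = "vec_space.rank n ?C"
  let ?S = "\<lambda>i. Poly_Mapping.single (lex_exponents n (d - 1) ! i) (1 :: 'a)"
  \<comment> \<open>Relations among derivatives are relations among the rows of \<open>?C\<close>,
    hence among the columns of its transpose, which has the same rank.\<close>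
  have CT: "?C\<^sup>T \<in> carrier_mat ?N n"
    using catalecticant_carrier by simp
  have r: "vec_space.rank ?N ?C\<^sup>T = ?r"
    by (rule rank_transpose[OF catalecticant_carrier])
  obtain e X where e: "\<forall>k<?r. e k < n"
    and X: "\<forall>i<?N. \<forall>j<n. ?C\<^sup>T $$ (i, j) = (\<Sum>k<?r. X j k * ?C\<^sup>T $$ (i, e k))"
    using vec_space.cols_spanned_by_rank_cols[OF CT, unfolded r] by (elim exE conjE) (rule that)
  let ?l = "\<lambda>k. \<Sum>j<n. Const (X j k) * Var j"
  have "f \<in> gen_algebra ?r ?l"
  proof (rule form_in_gen_algebra[OF f])
    show "(of_nat j :: 'a) \<noteq> 0" if "0 < j" "j \<le> d" for j
      using of_nat_neq_0_of_CHAR[OF char that] .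
    fix j assume j: "j < n"
    have "?C $$ (j, i) = (\<Sum>k<?r. X j k * ?C $$ (e k, i))" if i: "i < ?N" for i
    proof -
      have "?C $$ (j, i) = ?C\<^sup>T $$ (i, j)"
        using catalecticant_carrier[of n d f] i j by simp
      also have "\<dots> = (\<Sum>k<?r. X j k * ?C\<^sup>T $$ (i, e k))"
        using X i j by blast
      also have "\<dots> = (\<Sum>k<?r. X j k * ?C $$ (e k, i))"
        by (rule sum.cong) (use catalecticant_carrier[of n d f] e i in auto)
      finally show ?thesis .
    qed
    \<comment> \<open>Row \<open>j\<close> holds the coefficients of \<open>pdiff j f\<close>, so
      relations between rows become relations between derivatives.\<close>
    then have "pdiff j f = (\<Sum>i<?N. \<Sum>k<?r. Const (X j k) * (Const (?C $$ (e k, i)) * ?S i))"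
      unfolding pdiff_eq_catalecticant[OF d f j]
      by (intro sum.cong) (simp_all add: Const_sum Const_mult sum_distrib_right mult.assoc)
    also have "\<dots> = (\<Sum>k<?r. Const (X j k) * pdiff (e k) f)"
      by (subst sum.swap) (intro sum.cong refl, simp add: pdiff_eq_catalecticant[OF d f e[rule_format]] sum_distrib_left)
    finally show "pdiff j f = (\<Sum>k<?r. Const (X j k) * pdiff (e k) f)" .
  qed
  \<comment> \<open>The rank is an admissible value for the minimum in \<open>ess\<close>. This
    bounds \<open>ess\<close> from above and also shows that the minimum is attained, as the other
    bound needs.\<close>
  then have ex: "\<exists>l. (\<forall>k<?r. l k \<in> forms n 1) \<and> f \<in> gen_algebra ?r l"
    by (intro exI[of _ ?l] conjI allI impI linear_form_in_forms)
  show ?thesis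
  proof (rule antisym)
    obtain l where "\<And>k. k < ess n f \<Longrightarrow> l k \<in> forms n 1" "f \<in> gen_algebra (ess n f) l"
      using LeastI[of "\<lambda>r. \<exists>l. (\<forall>k<r. l k \<in> forms n 1) \<and> f \<in> gen_algebra r l", OF ex]
      unfolding ess_def by blast
    then show "?r \<le> ess n f"
      by (rule rank_catalecticant_le)
    show "ess n f \<le> ?r"
      unfolding ess_def by (rule Least_le) (rule ex)
  qed
qed

text \<open>The matrix determines the gradient, and Euler's identity recovers
  \<open>of_nat d\<close> times the form from it.\<close>

lemma inj_on_catalecticant:
  assumes d: "d \<ge> 1" and nz: "(of_nat d :: 'a::field) \<noteq> 0"
  shows "inj_on (catalecticant n d) (forms n d :: 'a mpol set)"
proof (rule inj_onI)
  fix f g :: "'a mpol"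
  assume f: "f \<in> forms n d" and g: "g \<in> forms n d" and eq: "catalecticant n d f = catalecticant n d g"
  have "pdiff i f = pdiff i g" if "i < n" for i
    by (simp only: pdiff_eq_catalecticant[OF d f that] pdiff_eq_catalecticant[OF d g that] eq)
  then have "Const (of_nat d) * f = Const (of_nat d) * g"
    by (simp flip: euler[OF f] euler[OF g])
  then have "of_nat d * Poly_Mapping.lookup f m = of_nat d * Poly_Mapping.lookup g m" for m
    by (metis lookup_Const_times)
  then show "f = g"
    using nz by (intro poly_mapping_eqI) simp
qed

theorem corollary5p4:
  fixes n d :: nat
  assumes "n \<ge> 1" and "d \<ge> 1"
    and "CHAR('a::field) = 0 \<or> CHAR('a) > d"
  shows "(\<forall>f \<in> forms n d. catalecticant n d (f :: 'a mpol) \<in> carrier_mat n ((n + d - 2) choose (d - 1))) \<and>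
    (\<forall>f \<in> forms n d. \<forall>g \<in> forms n d.
       catalecticant n d (f + g :: 'a mpol) = catalecticant n d f + catalecticant n d g) \<and>
    (\<forall>c. \<forall>f \<in> forms n d. catalecticant n d (Const c * f :: 'a mpol) = c \<cdot>\<^sub>m catalecticant n d f) \<and>
    (\<forall>f \<in> forms n d. \<forall>g \<in> forms n d.
       d_rk (catalecticant n d f) (catalecticant n d g) = d_ess n f (g :: 'a mpol)) \<and>
    inj_on (catalecticant n d) (forms n d :: 'a mpol set)"
proof -
  \<comment> \<open>By linearity the distance of the images is the rank of the catalecticant of
    \<open>f - g\<close>, again a form of degree \<open>d\<close>.\<close>
  have rank: "d_rk (catalecticant n d f) (catalecticant n d g) = d_ess n f g"
    if "f \<in> forms n d" "g \<in> forms n d" for f g :: "'a mpol"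
    using rank_catalecticant_eq_ess[OF assms(2,3) forms_diff[OF that]]
      catalecticant_carrier[of n d "f - g"]
    by (simp add: d_rk_def d_ess_def flip: catalecticant_diff)
  have "inj_on (catalecticant n d) (forms n d :: 'a mpol set)"
    using inj_on_catalecticant[OF assms(2) of_nat_neq_0_of_CHAR[OF assms(3)]] assms(2) by simp
  then show ?thesis
    by (intro conjI ballI allI rank catalecticant_carrier catalecticant_add catalecticant_Const_times)
qed

end
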